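(* Let $S$ be an additively idempotent parasemifield which is finitely generated as a semiring. Then $S$ is order-unital.
   Context: All semirings are commutative. A semiring is a non-empty set with two associative and commutative operations (addition and multiplication) such that multiplication distributes over addition; it is not required to contain $0$ or $1$. A non-trivial semiring is a parasemifield if its multiplicative structure is a non-trivial group (with identity $1$). A semiring is additively idempotent if $x+x=x$ for all $x$. "Finitely generated as a semiring" means generated by finitely many elements using only addition and multiplication. An additively idempotent parasemifield $S$ is order-unital if there exists an element $u\in S$ such that for each $s\in S$ there is $n\in\mathbb N$ (positive integers) with $u^n s+1=1$. *)

theory Defs
  imports Main
begin

(* The library class comm_semiring (no 0, no 1) is exactly a commutative semiring in the
   sense used here; comm_monoid_mult adds the identity 1 of the multiplicative group. *)
class parasemifield = comm_semiring + comm_monoid_mult +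
  assumes ex_mult_inverse: "\<exists>y. x * y = 1"
    and mult_group_nontrivial: "\<exists>x. x \<noteq> 1"

definition additively_idempotent :: "'a::comm_semiring itself \<Rightarrow> bool"
  where "additively_idempotent _ \<longleftrightarrow> (\<forall>x::'a. x + x = x)"

(* Closure under + and * only: neither 1 nor multiplicative inverses are added. *)
inductive_set semiring_generated :: "'a::comm_semiring set \<Rightarrow> 'a set"
  for A :: "'a set"
where
  base: "a \<in> A \<Longrightarrow> a \<in> semiring_generated A"
| add: "x \<in> semiring_generated A \<Longrightarrow> y \<in> semiring_generated A \<Longrightarrow> x + y \<in> semiring_generated A"
| mult: "x \<in> semiring_generated A \<Longrightarrow> y \<in> semiring_generated A \<Longrightarrow> x * y \<in> semiring_generated A"

definition finitely_generated_semiring :: "'a::comm_semiring itself \<Rightarrow> bool"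
  where "finitely_generated_semiring _ \<longleftrightarrow>
    (\<exists>A :: 'a set. finite A \<and> semiring_generated A = UNIV)"

definition order_unital :: "'a::parasemifield itself \<Rightarrow> bool"
  where "order_unital _ \<longleftrightarrow> (\<exists>u::'a. \<forall>s::'a. \<exists>n::nat. n > 0 \<and> u ^ n * s + 1 = 1)"

end

theory Submission
  imports Defs
begin

text \<open>
  In an additively idempotent semiring, \<open>x + y = y\<close> says \<open>x \<le> y\<close> for the natural order, in which
  \<open>x + y\<close> is the join of \<open>x\<close> and \<open>y\<close> and multiplication is monotone. Let \<open>b\<close> be the join of \<open>1\<close>
  and the finitely many generators. Since \<open>1 \<le> b\<close>, the powers of \<open>b\<close> increase, so the set of
  elements lying below some power of \<open>b\<close> is closed under \<open>+\<close> and \<open>*\<close>. It contains the generators,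
  hence is everything. From \<open>s \<le> b ^ n\<close> we get \<open>u ^ n * s \<le> 1\<close> for the inverse \<open>u\<close> of \<open>b\<close>, so
  \<open>u\<close> is the required element.
\<close>

lemma idempotent_mult_mono:
  fixes x y p q :: "'a::comm_semiring"
  assumes idem: "\<And>z::'a. z + z = z"
    and "x + p = p" and "y + q = q"
  shows "x * y + p * q = p * q"
proof -
  have pq: "p * q = x * y + (x * q + (p * y + p * q))"
  proof -
    have "p * q = (x + p) * (y + q)" using assms by simp
    then show ?thesis by (simp add: distrib_left distrib_right add.assoc add.left_commute)
  qed
  have "x * y + p * q = (x * y + x * y) + (x * q + (p * y + p * q))"
    by (subst pq) (simp only: add.assoc)
  also have "\<dots> = p * q" using pq idem by simp
  finally show ?thesis .
qed

text \<open>The element \<open>1\<close> is included among the bounded elements so that the powers of \<open>b\<close> increase.\<close>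

lemma finite_set_upper_bound_above_one:
  fixes A :: "'a::parasemifield set"
  assumes idem: "\<And>z::'a. z + z = z" and "finite A"
  obtains b where "1 + b = b" and "\<And>a. a \<in> A \<Longrightarrow> a + b = b"
proof -
  have "\<exists>b. 1 + b = b \<and> (\<forall>a\<in>A. a + b = b)"
    using \<open>finite A\<close>
  proof induction
    case empty
    show ?case using idem by auto
  next
    case (insert c A)
    then obtain b where b: "1 + b = b" "\<And>a. a \<in> A \<Longrightarrow> a + b = b" by blast
    have "1 + (c + b) = c + b" "c + (c + b) = c + b"
      using b(1) idem by (metis add.left_commute, metis add.assoc)
    moreover have "a + (c + b) = c + b" if "a \<in> A" for a
      using b(2)[OF that] by (metis add.left_commute)
    ultimately show ?case by blast
  qed
  then show ?thesis using that by blast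
qed

lemma one_below_power:
  fixes b :: "'a::parasemifield"
  assumes idem: "\<And>z::'a. z + z = z" and "1 + b = b"
  shows "1 + b ^ n = b ^ n"
proof (induction n)
  case 0
  show ?case using idem by simp
next
  case (Suc n)
  then show ?case using idempotent_mult_mono[OF idem \<open>1 + b = b\<close>, of 1 "b ^ n"] by simp
qed

lemma semiring_generated_below_power:
  fixes A :: "'a::parasemifield set"
  assumes idem: "\<And>z::'a. z + z = z"
    and one: "1 + b = b" and gen: "\<And>a. a \<in> A \<Longrightarrow> a + b = b"
    and "s \<in> semiring_generated A"
  shows "\<exists>n>0. s + b ^ n = b ^ n"
  using \<open>s \<in> semiring_generated A\<close>
proof induction
  case (base a)
  then have "a + b ^ 1 = b ^ 1" using gen by simp
  then show ?case by (intro exI[of _ 1]) simp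
next
  case (add x y)
  then obtain m n where mn: "m > 0" "x + b ^ m = b ^ m" "n > 0" "y + b ^ n = b ^ n" by blast
  \<comment> \<open>Multiplying with \<open>1 \<le> b ^ n\<close> or \<open>1 \<le> b ^ m\<close> lifts both bounds to the common
     exponent \<open>m + n\<close>.\<close>
  have "x + b ^ (m + n) = b ^ (m + n)"
    using idempotent_mult_mono[OF idem mn(2) one_below_power[OF idem one, of n]]
    by (simp add: power_add)
  moreover have "y + b ^ (m + n) = b ^ (m + n)"
    using idempotent_mult_mono[OF idem one_below_power[OF idem one, of m] mn(4)]
    by (simp add: power_add)
  ultimately have "(x + y) + b ^ (m + n) = b ^ (m + n)" by (simp add: add.assoc)
  then show ?case using mn(1) by (intro exI[of _ "m + n"]) simp
next
  case (mult x y)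
  then obtain m n where mn: "m > 0" "x + b ^ m = b ^ m" "n > 0" "y + b ^ n = b ^ n" by blast
  then have "x * y + b ^ (m + n) = b ^ (m + n)"
    using idempotent_mult_mono[OF idem mn(2) mn(4)] by (simp add: power_add)
  then show ?case using mn(1) by (intro exI[of _ "m + n"]) simp
qed

theorem theorem3p6:
  assumes "additively_idempotent TYPE('a::parasemifield)"
    and "finitely_generated_semiring TYPE('a)"
  shows "order_unital TYPE('a)"
proof -
  have idem: "z + z = z" for z :: 'a
    using assms(1) by (simp add: additively_idempotent_def)
  obtain A :: "'a set" where A: "finite A" "semiring_generated A = UNIV"
    using assms(2) by (auto simp: finitely_generated_semiring_def)
  obtain b where b: "1 + b = b" "\<And>a. a \<in> A \<Longrightarrow> a + b = b"
    using finite_set_upper_bound_above_one[OF idem A(1)] by blast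
  obtain u where u: "b * u = 1" using ex_mult_inverse by blast
  have "\<exists>n>0. u ^ n * s + 1 = 1" for s
  proof -
    obtain n where n: "n > 0" "s + b ^ n = b ^ n"
      using semiring_generated_below_power[OF idem b] A(2) by blast
    have "u ^ n * b ^ n = 1"
      using u by (metis mult.commute power_mult_distrib power_one)
    then have "u ^ n * s + 1 = 1" using n(2) by (metis distrib_left)
    with n(1) show ?thesis by blast
  qed
  then show ?thesis unfolding order_unital_def by blast
qed

end
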